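(* Let $\zeta$ be the Riemann zeta function. For all real $\sigma\ge\tfrac12$ and $t\ge2$, $$|\zeta(\sigma+it)|\le 3t.$$ *)

theory Defs
  imports "HOL-Complex_Analysis.Complex_Analysis"
begin

(* The Riemann zeta function: the unique holomorphic continuation to the plane minus 1 of the
   Dirichlet series of n powr (-s), n >= 1, Re s > 1.  The clause f 1 = 0 only fixes the
   value at the pole, which holomorphy on -{1} leaves open, so that the description is unique. *)
definition zeta :: "complex \<Rightarrow> complex" where
  "zeta = (THE f. f holomorphic_on (- {1}) \<and>
                  (\<forall>s. Re s > 1 \<longrightarrow> (\<lambda>n. 1 / of_nat (Suc n) powr s) sums f s) \<and>
                  f 1 = 0)"

end

(* Write zeta(s, a) for the Hurwitz zeta function.  Integrating the remainder of each term of the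
   Dirichlet series by parts gives, for Re s > 1,
     (s - 1) zeta(s, a) = a^(1-s) + (s - 1) INT_0^1 (1 - v) s zeta(s + 1, a + v) dv,
   and s zeta(s + 1, .) is the same entire function as on the left, shifted by one.  Iterating the
   identity therefore continues (s - 1) zeta(s, a) to the whole plane, one unit at a time.  One step
   already reaches Re s > 0, where telescoping gives |zeta(s)| <= 1/|s - 1| + |s| / Re s. *)
theory Submission
  imports Defs
begin

section \<open>Holomorphic parameter integrals\<close>

text \<open>By Morera: the integral over a triangle may be taken inside the integral over
  \<open>v\<close>, where Cauchy's theorem makes it vanish for each fixed \<open>v\<close>.\<close>

lemma holomorphic_on_integral_param:
  fixes f :: "complex \<Rightarrow> real \<Rightarrow> complex"
  assumes S: "open S"
    and cont: "continuous_on (S \<times> {a..b}) (\<lambda>(s, v). f s v)"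
    and hol: "\<And>v. v \<in> {a..b} \<Longrightarrow> (\<lambda>s. f s v) holomorphic_on S"
  shows "(\<lambda>s. integral {a..b} (f s)) holomorphic_on S"
proof -
  have contI: "continuous_on S (\<lambda>s. integral {a..b} (f s))"
    using integral_continuous_on_param[of S a b f] cont by simp
  \<comment> \<open>Fubini along one segment. Continuity in \<open>v\<close> is kept as well, since
    adding the three sides of a triangle under one integral requires integrability.\<close>
  have line: "continuous_on {a..b} (\<lambda>v. contour_integral (linepath x y) (\<lambda>s. f s v)) \<and>
        contour_integral (linepath x y) (\<lambda>s. integral {a..b} (f s)) =
        integral {a..b} (\<lambda>v. contour_integral (linepath x y) (\<lambda>s. f s v))"
    if "closed_segment x y \<subseteq> S" for x y
  proof -
    have mem: "linepath x y u \<in> S" if "u \<in> {0..1}" for u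
      using \<open>closed_segment x y \<subseteq> S\<close> that by (metis path_image_linepath path_image_def imageI subsetD)
    have c1: "continuous_on ({0..1} \<times> {a..b}) (\<lambda>(u, v). f (linepath x y u) v * (y - x))"
      unfolding split_def
      by (intro continuous_intros continuous_on_compose2[OF cont[unfolded split_def],
            of _ "\<lambda>p. (linepath x y (fst p), snd p)", simplified])
         (auto intro!: continuous_intros continuous_on_compose2[OF continuous_on_linepath] mem)
    have c2: "continuous_on ({a..b} \<times> {0..1}) (\<lambda>(v, u). f (linepath x y u) v * (y - x))"
      unfolding split_def
      by (rule continuous_on_compose2[OF c1[unfolded split_def], of _ "\<lambda>p. (snd p, fst p)", simplified])
         (auto intro!: continuous_intros)
    have "integral {0..1} (\<lambda>u. integral {a..b} (\<lambda>v. f (linepath x y u) v * (y - x))) =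
          integral {a..b} (\<lambda>v. integral {0..1} (\<lambda>u. f (linepath x y u) v * (y - x)))"
      using integral_swap_continuous[of 0 a 1 b "\<lambda>u v. f (linepath x y u) v * (y - x)"] c1
      by (simp add: cbox_Pair_eq)
    moreover have "continuous_on {a..b} (\<lambda>v. integral {0..1} (\<lambda>u. f (linepath x y u) v * (y - x)))"
      using integral_continuous_on_param[of "{a..b}" 0 1 "\<lambda>v u. f (linepath x y u) v * (y - x)"] c2
      by simp
    ultimately show ?thesis
      by (simp add: contour_integral_integral integral_mult_left)
  qed
  have "(\<lambda>s. integral {a..b} (f s)) analytic_on S"
  proof (rule Morera_triangle[OF contI S], intro impI)
    fix x y z assume T: "convex hull {x, y, z} \<subseteq> S"
    let ?c = "\<lambda>x y v. contour_integral (linepath x y) (\<lambda>s. f s v)"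
    have seg: "closed_segment x y \<subseteq> S" "closed_segment y z \<subseteq> S" "closed_segment z x \<subseteq> S"
      
      by (intro subset_trans[OF _ T] closed_segment_subset convex_convex_hull; simp add: hull_inc)+
    have int: "?c x y integrable_on {a..b}" "?c y z integrable_on {a..b}" "?c z x integrable_on {a..b}"
      using seg line by (auto intro!: integrable_continuous_real)
    have "integral {a..b} (?c x y) + integral {a..b} (?c y z) + integral {a..b} (?c z x) =
        integral {a..b} (\<lambda>v. ?c x y v + ?c y z v + ?c z x v)"
      using int by (simp add: integral_add integrable_add)
    also have "\<dots> = integral {a..b} (\<lambda>v. 0)"
    proof (rule integral_cong)
      fix v assume v: "v \<in> {a..b}"
      have "(\<lambda>s. f s v) holomorphic_on convex hull {x, y, z}"
        using hol[OF v] T holomorphic_on_subset by blast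
      then show "?c x y v + ?c y z v + ?c z x v = 0"
        using Cauchy_theorem_triangle[of "\<lambda>s. f s v" x y z]
          contour_integral_unique by (auto simp: contour_integral_join contour_integrable_join
            dest!: contour_integral_unique has_chain_integral_chain_integral3)
    qed
    finally show "contour_integral (linepath x y) (\<lambda>s. integral {a..b} (f s)) +
        contour_integral (linepath y z) (\<lambda>s. integral {a..b} (f s)) +
        contour_integral (linepath z x) (\<lambda>s. integral {a..b} (f s)) = 0"
      using line seg by simp
  qed
  then show ?thesis by (rule analytic_imp_holomorphic)
qed

section \<open>The Hurwitz series\<close>

text \<open>The Hurwitz zeta function zeta(s, a) as a bare series, used where Re s > 1 and a \<ge>
  1; the case a = 1 is the Riemann zeta function, and the shifts a + v below keep a \<ge> 1.\<close>

definition hsum :: "complex \<Rightarrow> real \<Rightarrow> complex" where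
  "hsum s a = (\<Sum>n. of_real (real n + a) powr (- s))"

lemma norm_of_real_powr:
  assumes "x > 0"
  shows "norm (complex_of_real x powr s) = x powr Re s"
  using assms by (simp add: norm_powr_real_powr)

lemma summable_Suc_powr:
  assumes "\<epsilon> > 0"
  shows "summable (\<lambda>n. real (Suc n) powr (- (1 + \<epsilon>)))"
  using summable_real_powr_iff[of "- (1 + \<epsilon>)"] assms by (subst summable_Suc_iff) simp

text \<open>The majorant depends on neither \<open>s\<close> nor \<open>a\<close>, so the
  Weierstrass test gives convergence uniform in both variables at once.\<close>

lemma hurwitz_term_bound:
  assumes "\<epsilon> > 0" "1 + \<epsilon> \<le> Re s" "a \<ge> 1"
  shows "norm (complex_of_real (real n + a) powr (- s)) \<le> real (Suc n) powr (- (1 + \<epsilon>))"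
proof -
  have "norm (complex_of_real (real n + a) powr (- s)) = (real n + a) powr (- Re s)"
    using assms norm_of_real_powr[of "real n + a" "- s"] by simp
  also have "\<dots> \<le> (real n + a) powr (- (1 + \<epsilon>))"
    using assms by (intro powr_mono) auto
  also have "\<dots> \<le> real (Suc n) powr (- (1 + \<epsilon>))"
    using assms by (intro powr_mono2') auto
  finally show ?thesis .
qed

text \<open>Uniformity in the pair serves three ends: joint continuity, holomorphy in
  \<open>s\<close>, and termwise integration in \<open>a\<close>.\<close>

lemma uniform_limit_hsum:
  assumes "\<epsilon> > 0"
  shows "uniform_limit ({s. 1 + \<epsilon> \<le> Re s} \<times> {1..})
    (\<lambda>N p. \<Sum>n<N. complex_of_real (real n + snd p) powr (- fst p))
    (\<lambda>p. hsum (fst p) (snd p)) sequentially"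
  unfolding hsum_def
  by (rule Weierstrass_m_test[OF _ summable_Suc_powr[OF assms]])
     (use assms hurwitz_term_bound in auto)

lemma hsum_sums:
  assumes "Re s > 1" "a \<ge> 1"
  shows "(\<lambda>n. complex_of_real (real n + a) powr (- s)) sums hsum s a"
proof -
  have "summable (\<lambda>n. complex_of_real (real n + a) powr (- s))"
    by (rule summable_comparison_test[OF _ summable_Suc_powr[of "Re s - 1"]])
       (use assms hurwitz_term_bound[of "Re s - 1" s a] in auto)
  then show ?thesis unfolding hsum_def by (rule summable_sums)
qed

text \<open>A positive real base stays off the branch cut, so the power is exp(g ln f) with the real
  logarithm.\<close>

lemma continuous_on_of_real_powr:
  assumes "continuous_on A f" "continuous_on A g" "\<And>x. x \<in> A \<Longrightarrow> f x > 0"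
  shows "continuous_on A (\<lambda>x. complex_of_real (f x) powr g x)"
proof -
  have "continuous_on A (\<lambda>x. exp (g x * of_real (ln (f x))))"
    using assms by (force intro!: continuous_intros)
  then show ?thesis
    by (rule continuous_on_eq) (use assms(3) in \<open>force simp: powr_def Ln_of_real\<close>)
qed

lemma continuous_on_hsum:
  "continuous_on ({s. Re s > 1} \<times> {1..}) (\<lambda>p. hsum (fst p) (snd p))"
  unfolding continuous_on_eq_continuous_within
proof
  fix p :: "complex \<times> real" assume p: "p \<in> {s. Re s > 1} \<times> {1..}"
  define \<epsilon> where "\<epsilon> = (Re (fst p) - 1) / 2"
  have \<epsilon>: "\<epsilon> > 0" "1 + \<epsilon> < Re (fst p)" using p by (auto simp: \<epsilon>_def field_simps)
  have "continuous_on ({s. 1 + \<epsilon> \<le> Re s} \<times> {1..}) (\<lambda>p. hsum (fst p) (snd p))"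
    by (rule uniform_limit_theorem[OF _ uniform_limit_hsum])
       (use \<epsilon> in \<open>auto intro!: always_eventually continuous_on_sum continuous_on_of_real_powr continuous_intros
             simp del: of_real_add\<close>)
  then have c: "continuous (at p within {s. 1 + \<epsilon> \<le> Re s} \<times> {1..}) (\<lambda>p. hsum (fst p) (snd p))"
    using p \<epsilon> by (auto simp: continuous_on_eq_continuous_within)
  \<comment> \<open>The convergence is uniform only on smaller half-planes; as \<open>p\<close> lies
    strictly inside one of them, continuity within it is continuity within the whole domain.\<close>
  have "at p within {s. 1 + \<epsilon> \<le> Re s} \<times> {1..} = at p within {s. Re s > 1} \<times> {1..}"
    by (rule at_within_nhd[of _ "{s. 1 + \<epsilon> < Re s} \<times> UNIV"])
       (use p \<epsilon> in \<open>auto intro!: open_Times simp: open_halfspace_Re_gt mem_Times_iff\<close>)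
  with c show "continuous (at p within {s. Re s > 1} \<times> {1..}) (\<lambda>p. hsum (fst p) (snd p))"
    by simp
qed

lemma holomorphic_on_hsum:
  assumes "a \<ge> 1"
  shows "(\<lambda>s. hsum s a) holomorphic_on {s. Re s > 1}"
proof (rule holomorphic_uniform_sequence[OF open_halfspace_Re_gt,
      where f = "\<lambda>N s. \<Sum>n<N. complex_of_real (real n + a) powr (- s)"])
  fix z assume z: "z \<in> {s. Re s > 1}"
  define \<epsilon> where "\<epsilon> = (Re z - 1) / 2"
  have \<epsilon>: "\<epsilon> > 0" using z by (auto simp: \<epsilon>_def)
  \<comment> \<open>The radius is half the distance from \<open>z\<close> to the line Re s = 1, so
    the closed ball keeps distance at least \<epsilon> from that line.\<close>
  have sub: "1 + \<epsilon> \<le> Re s" if "s \<in> cball z \<epsilon>" for s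
  proof -
    have "Re z - Re s \<le> norm (z - s)" by (metis complex_Re_le_cmod minus_complex.sel(1))
    with that show ?thesis by (auto simp: \<epsilon>_def dist_norm field_simps)
  qed
  have "uniform_limit (cball z \<epsilon>) (\<lambda>N s. \<Sum>n<N. complex_of_real (real n + a) powr (- s))
      (\<lambda>s. hsum s a) sequentially"
    using uniform_limit_compose'[OF uniform_limit_hsum[OF \<epsilon>], of "\<lambda>s. (s, a)" "cball z \<epsilon>"]
      sub assms by auto
  then show "\<exists>d>0. cball z d \<subseteq> {s. Re s > 1} \<and> uniform_limit (cball z d)
      (\<lambda>N s. \<Sum>n<N. complex_of_real (real n + a) powr (- s)) (\<lambda>s. hsum s a) sequentially"
    using \<epsilon> sub by (intro exI[of _ \<epsilon>]) force
qed (auto intro!: holomorphic_intros)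

section \<open>Continuation by one unit to the left\<close>

text \<open>Integration by parts. The value is the error in replacing the integral of u^(-s) over
  [x, x + 1] by its integrand at the left endpoint.\<close>

lemma has_integral_hurwitz_term:
  fixes s :: complex
  assumes "x > 0" "s \<noteq> 1"
  shows "((\<lambda>v. of_real (1 - v) * (s * of_real (x + v) powr (- (s + 1)))) has_integral
      of_real x powr (- s) - (of_real x powr (1 - s) - of_real (x + 1) powr (1 - s)) / (s - 1)) {0..1}"
proof -
  \<comment> \<open>The first summand is the weight 1 - v times an antiderivative of s (x +
    v)^(-s-1); the second cancels the term arising from the derivative of the weight.\<close>
  define F where "F v = - (of_real (1 - v) * of_real (x + v) powr (- s)) +
      of_real (x + v) powr (1 - s) / (s - 1)" for v
  have pw: "((\<lambda>v. complex_of_real (x + v) powr w) has_vector_derivative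
      w * of_real (x + v) powr (w - 1)) (at v within {0..1})" if "v \<in> {0..1}" for v w
  proof -
    have "complex_of_real (x + v) \<notin> \<real>\<^sub>\<le>\<^sub>0"
      using assms that by (simp add: nonpos_Reals_of_real_iff del: of_real_add)
    from has_field_derivative_powr[OF this, of w]
    have "((\<lambda>z. (of_real x + z) powr w) has_field_derivative w * of_real (x + v) powr (w - 1))
        (at (of_real v))"
      using DERIV_shift[of "\<lambda>z. z powr w" _ "complex_of_real v" "complex_of_real x"]
      by (simp add: add.commute)
    from has_vector_derivative_real_field[OF this] show ?thesis by simp
  qed
  have "((\<lambda>v. of_real (1 - v) * (s * of_real (x + v) powr (- (s + 1)))) has_integral F 1 - F 0) {0..1}"
  proof (rule fundamental_theorem_of_calculus)
    fix v :: real assume v: "v \<in> {0..1}"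
    have "((\<lambda>v. complex_of_real (1 - v)) has_vector_derivative - 1) (at v within {0..1})"
      by (auto intro!: derivative_eq_intros)
    note d = this pw[OF v, of "-s"] pw[OF v, of "1 - s"]
    have "(F has_vector_derivative
       - (of_real (1 - v) * (- s * of_real (x + v) powr (- s - 1)) + (- 1) * of_real (x + v) powr (- s))
       + (1 - s) * of_real (x + v) powr (1 - s - 1) / (s - 1)) (at v within {0..1})"
      unfolding F_def
      by (intro has_vector_derivative_add has_vector_derivative_minus has_vector_derivative_mult
          has_vector_derivative_divide d)
    moreover have "- (of_real (1 - v) * (- s * of_real (x + v) powr (- s - 1)) + (- 1) * of_real (x + v) powr (- s))
       + (1 - s) * of_real (x + v) powr (1 - s - 1) / (s - 1) =
       of_real (1 - v) * (s * of_real (x + v) powr (- (s + 1)))"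
    proof -
      have "(1 - s) * c / (s - 1) = - c" for c
        using assms by (simp add: field_simps)
      moreover have "1 - s - 1 = - s" "- (s + 1) = - s - 1" by auto
      ultimately show ?thesis by (simp only:) simp
    qed
    ultimately show "(F has_vector_derivative of_real (1 - v) * (s * of_real (x + v) powr (- (s + 1))))
        (at v within {0..1})"
      by (simp only:)
  qed simp
  moreover have "F 1 - F 0 = of_real x powr (- s) -
      (of_real x powr (1 - s) - of_real (x + 1) powr (1 - s)) / (s - 1)"
    using assms by (simp add: F_def diff_divide_distrib)
  ultimately show ?thesis by simp
qed

text \<open>The terms are the integrals of the preceding lemma, and the series at s + 1 converges
  uniformly in \<open>v\<close> as soon as Re s > 0. The combined series thus converges there,
  although its two parts need not do so separately when Re s \<le> 1.\<close>

lemma hurwitz_shift_sums: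
  assumes "Re s > 0" "s \<noteq> 1" "a \<ge> 1"
  shows "(\<lambda>n. of_real (real n + a) powr (- s) -
      (of_real (real n + a) powr (1 - s) - of_real (real (Suc n) + a) powr (1 - s)) / (s - 1)) sums
    integral {0..1} (\<lambda>v. of_real (1 - v) * (s * hsum (s + 1) (a + v)))"
proof -
  define h where "h N v = of_real (1 - v) * (s * (\<Sum>n<N. complex_of_real (real n + (a + v)) powr (- (s + 1))))"
    for N v
  have ul: "uniform_limit {0..1} h (\<lambda>v. of_real (1 - v) * (s * hsum (s + 1) (a + v))) sequentially"
  proof -
    have "uniform_limit {0..1} (\<lambda>N v. \<Sum>n<N. complex_of_real (real n + (a + v)) powr (- (s + 1)))
        (\<lambda>v. hsum (s + 1) (a + v)) sequentially"
      using uniform_limit_compose'[OF uniform_limit_hsum[OF assms(1)], of "\<lambda>v. (s + 1, a + v)" "{0..1}"] assms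
      by auto
    \<comment> \<open>A product of uniform limits is handled by bounding both limit functions, here
      by compactness of [0, 1].\<close>
    moreover have "continuous_on {0..1} (\<lambda>v. hsum (s + 1) (a + v))"
      by (rule continuous_on_compose2[OF continuous_on_hsum, of _ "\<lambda>v. (s + 1, a + v)", simplified])
         (use assms in \<open>auto intro!: continuous_intros\<close>)
    then have "bounded ((\<lambda>v. hsum (s + 1) (a + v)) ` {0..1})"
      by (intro compact_imp_bounded compact_continuous_image) auto
    moreover have "bounded ((\<lambda>v. complex_of_real (1 - v) * s) ` {0..1})"
      by (intro compact_imp_bounded compact_continuous_image continuous_intros) auto
    ultimately have "uniform_limit {0..1}
        (\<lambda>N v. of_real (1 - v) * s * (\<Sum>n<N. complex_of_real (real n + (a + v)) powr (- (s + 1))))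
        (\<lambda>v. of_real (1 - v) * s * hsum (s + 1) (a + v)) sequentially"
      by (intro uniform_lim_mult uniform_limit_const)
    then show ?thesis unfolding h_def mult.assoc .
  qed
  have cont: "continuous_on {0..1} (h N)" for N
    unfolding h_def using assms
    by (intro continuous_intros continuous_on_of_real_powr) auto
  obtain I J where IJ: "\<And>N. (h N has_integral I N) {0..1}"
      "((\<lambda>v. of_real (1 - v) * (s * hsum (s + 1) (a + v))) has_integral J) {0..1}" "I \<longlonglongrightarrow> J"
    using uniform_limit_integral[OF ul cont] by auto
  let ?g = "\<lambda>n. of_real (real n + a) powr (- s) -
      (of_real (real n + a) powr (1 - s) - of_real (real (Suc n) + a) powr (1 - s)) / (s - 1)"
  have "(h N has_integral (\<Sum>n<N. ?g n)) {0..1}" for N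
  proof -
    have "((\<lambda>v. \<Sum>n<N. of_real (1 - v) * (s * complex_of_real (real n + a + v) powr (- (s + 1))))
        has_integral (\<Sum>n<N. ?g n)) {0..1}"
    proof (intro has_integral_sum finite_lessThan)
      fix n
      show "((\<lambda>v. of_real (1 - v) * (s * complex_of_real (real n + a + v) powr (- (s + 1))))
        has_integral ?g n) {0..1}"
        using has_integral_hurwitz_term[of "real n + a" s] assms by (simp add: add_ac)
    qed
    moreover have "h N = (\<lambda>v. \<Sum>n<N. of_real (1 - v) *
        (s * complex_of_real (real n + a + v) powr (- (s + 1))))"
      by (simp add: h_def fun_eq_iff sum_distrib_left add_ac)
    ultimately show ?thesis by simp
  qed
  then have "I = (\<lambda>N. \<Sum>n<N. ?g n)"
    using IJ(1) has_integral_unique by blast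
  with IJ show ?thesis by (simp add: sums_def integral_unique)
qed

lemma tendsto_of_real_powr_0:
  assumes "Re w < 0"
  shows "(\<lambda>n. complex_of_real (real n + a) powr w) \<longlonglongrightarrow> 0"
proof (rule tendsto_norm_zero_cancel)
  have "(\<lambda>n. (real n + a) powr Re w) \<longlonglongrightarrow> 0"
    by (rule tendsto_neg_powr[OF assms])
       (auto intro!: filterlim_tendsto_add_at_top filterlim_real_sequentially simp: add.commute)
  \<comment> \<open>With \<open>a\<close> arbitrary, the base is known to be positive only from some
    index on.\<close>
  moreover have "\<forall>\<^sub>F n in sequentially. norm (complex_of_real (real n + a) powr w) = (real n + a) powr Re w"
  proof -
    have "\<forall>\<^sub>F n in sequentially. real n > - a"
      using filterlim_real_sequentially by (auto simp: filterlim_at_top_dense)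
    then show ?thesis by eventually_elim (simp add: norm_of_real_powr del: of_real_add)
  qed
  ultimately show "(\<lambda>n. norm (complex_of_real (real n + a) powr w)) \<longlonglongrightarrow> 0"
    by (simp add: tendsto_cong)
qed

text \<open>For Re s > 1 the two parts of the shifted series converge separately, and the second
  telescopes to a^(1-s) / (s - 1). Multiplication by s - 1 clears the pole, and s
  \<open>hsum\<close> (s + 1) (a + v) is the left side again at (s + 1, a + v), which allows
  iteration.\<close>

lemma hsum_shift:
  assumes "Re s > 1" "a \<ge> 1"
  shows "(s - 1) * hsum s a = of_real a powr (1 - s) +
    (s - 1) * integral {0..1} (\<lambda>v. of_real (1 - v) * (s * hsum (s + 1) (a + v)))"
proof -
  have [simp]: "s \<noteq> 1" using assms by auto
  have "(\<lambda>n. complex_of_real (real n + a) powr (1 - s)) \<longlonglongrightarrow> 0"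
    using assms by (intro tendsto_of_real_powr_0) simp
  from sums_divide[OF telescope_sums'[OF this], of "s - 1"]
  have "(\<lambda>n. (of_real (real n + a) powr (1 - s) - of_real (real (Suc n) + a) powr (1 - s)) / (s - 1))
      sums (of_real a powr (1 - s) / (s - 1))" by simp
  from sums_diff[OF hsum_sums[OF assms] this]
  have "hsum s a - of_real a powr (1 - s) / (s - 1) =
      integral {0..1} (\<lambda>v. of_real (1 - v) * (s * hsum (s + 1) (a + v)))"
    using hurwitz_shift_sums[of s a] assms sums_unique2 by force
  then show ?thesis by (auto simp: field_simps)
qed

section \<open>Iterating the shift to reach the whole plane\<close>

text \<open>\<open>Zext m s a\<close> is \<open>(s - 1) \<zeta>(s, a)\<close>, meaningful for \<open>Re s > 1 - m\<close> and \<open>a \<ge> 1\<close>.\<close>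

primrec Zext :: "nat \<Rightarrow> complex \<Rightarrow> real \<Rightarrow> complex" where
  "Zext 0 s a = (s - 1) * hsum s a"
| "Zext (Suc m) s a = of_real a powr (1 - s) +
     (s - 1) * integral {0..1} (\<lambda>v. of_real (1 - v) * Zext m (s + 1) (a + v))"

text \<open>Both claims go through one induction: the parameter integral in the next step needs
  joint continuity as well as holomorphy for each \<open>a\<close>. Passing from \<open>s\<close> to
  s + 1 gains the unit by which the half-plane grows.\<close>

lemma Zext_regular:
  "continuous_on ({s. Re s > 1 - real m} \<times> {1..}) (\<lambda>p. Zext m (fst p) (snd p)) \<and>
   (\<forall>a\<ge>1. (\<lambda>s. Zext m s a) holomorphic_on {s. Re s > 1 - real m})"
proof (induction m)
  case 0
  then show ?case
    using continuous_on_hsum holomorphic_on_hsum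
    by (auto intro!: continuous_intros holomorphic_intros)
next
  case (Suc m)
  let ?S = "{s. Re s > 1 - real (Suc m)}"
  let ?f = "\<lambda>s a v. of_real (1 - v) * Zext m (s + 1) (a + v)"
  note cont = conjunct1[OF Suc] and hol = conjunct2[OF Suc, rule_format]
  have c: "continuous_on ((?S \<times> {1..}) \<times> {0..1}) (\<lambda>(p, v). ?f (fst p) (snd p) v)"
    unfolding split_def
    by (intro continuous_intros
        continuous_on_compose2[OF cont, of _ "\<lambda>q. (fst (fst q) + 1, snd (fst q) + snd q)", simplified])
       auto
  have "continuous_on (?S \<times> {1..}) (\<lambda>p. integral {0..1} (?f (fst p) (snd p)))"
    using integral_continuous_on_param[of "?S \<times> {1..}" 0 1 "\<lambda>p. ?f (fst p) (snd p)"] c by simp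
  then have "continuous_on (?S \<times> {1..}) (\<lambda>p. Zext (Suc m) (fst p) (snd p))"
    by (auto intro!: continuous_intros continuous_on_of_real_powr)
  moreover have "(\<lambda>s. Zext (Suc m) s a) holomorphic_on ?S" if "a \<ge> 1" for a
  proof -
    have "(\<lambda>s. integral {0..1} (?f s a)) holomorphic_on ?S"
    proof (rule holomorphic_on_integral_param[OF open_halfspace_Re_gt])
      show "continuous_on (?S \<times> {0..1}) (\<lambda>(s, v). ?f s a v)"
        unfolding split_def
        by (rule continuous_on_compose2[OF c[unfolded split_def],
              of _ "\<lambda>q. ((fst q, a), snd q)", unfolded fst_conv snd_conv])
           (use that in \<open>auto intro!: continuous_intros\<close>)
      fix v :: real assume "v \<in> {0..1}"
      then have "(\<lambda>s. Zext m s (a + v)) holomorphic_on {s. Re s > 1 - real m}"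
        using hol[of "a + v"] that by simp
      then have "((\<lambda>s. Zext m s (a + v)) \<circ> (\<lambda>s. s + 1)) holomorphic_on ?S"
        by (intro holomorphic_on_compose_gen) (auto intro!: holomorphic_intros)
      then show "(\<lambda>s. ?f s a v) holomorphic_on ?S"
        by (auto simp: o_def intro!: holomorphic_intros)
    qed
    then show ?thesis by (auto intro!: holomorphic_intros)
  qed
  ultimately show ?case by blast
qed

text \<open>For m = 0 this is \<open>hsum_shift\<close>; under the integral the recursion evaluates
  at s + 1, so agreement moves one unit to the left at each step.\<close>

lemma Zext_Suc_eq:
  assumes "Re s > 1 - real m" "a \<ge> 1"
  shows "Zext (Suc m) s a = Zext m s a"
  using assms
proof (induction m arbitrary: s a)
  case 0
  then show ?case using hsum_shift[of s a] by simp
next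
  case (Suc m)
  have "integral {0..1} (\<lambda>v. of_real (1 - v) * Zext (Suc m) (s + 1) (a + v)) =
      integral {0..1} (\<lambda>v. of_real (1 - v) * Zext m (s + 1) (a + v))"
    using Suc by (intro integral_cong) (simp del: Zext.simps)
  then show ?case by (simp only: Zext.simps(2)[of "Suc m"] Zext.simps(2)[of m])
qed

lemma Zext_stable:
  assumes "m \<le> k" "Re s > 1 - real m" "a \<ge> 1"
  shows "Zext k s a = Zext m s a"
  using assms
proof (induction k rule: dec_induct)
  case (step k)
  then show ?case using Zext_Suc_eq[of k s a] by (simp del: Zext.simps)
qed simp

section \<open>The zeta function\<close>

text \<open>The depth m = \<open>nat \<lceil>2 - Re s\<rceil>\<close> satisfies m \<ge> 2 - Re s,
  hence 1 - m < Re s. The value at 1 matches the normalisation in \<open>zeta\<close>.\<close>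

definition zeta_ext :: "complex \<Rightarrow> complex" where
  "zeta_ext s = (if s = 1 then 0 else Zext (nat \<lceil>2 - Re s\<rceil>) s 1 / (s - 1))"

text \<open>Frees the depth from its dependence on \<open>s\<close>: a single \<open>m\<close> then
  describes the function on a whole half-plane, as needed for holomorphy.\<close>

lemma zeta_ext_eq:
  assumes "Re s > 1 - real m" "s \<noteq> 1"
  shows "zeta_ext s = Zext m s 1 / (s - 1)"
proof -
  let ?k = "nat \<lceil>2 - Re s\<rceil>"
  have "Re s > 1 - real ?k" by linarith
  then have "Zext ?k s 1 = Zext m s 1"
    using Zext_stable[of m ?k s 1] Zext_stable[of ?k m s 1] assms by (cases "m \<le> ?k") auto
  then show ?thesis using assms by (simp add: zeta_ext_def)
qed

lemma zeta_ext_holomorphic: "zeta_ext holomorphic_on (- {1})"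
  unfolding holomorphic_on_open[OF open_delete[OF open_UNIV], folded Compl_eq_Diff_UNIV]
proof
  fix z :: complex assume z: "z \<in> - {1}"
  define m where "m = nat \<lceil>2 - Re z\<rceil>"
  let ?S = "{s. Re s > 1 - real m} - {1}"
  have op: "open ?S" by (intro open_Diff open_halfspace_Re_gt) auto
  have "(\<lambda>s. Zext m s 1 / (s - 1)) holomorphic_on ?S"
    using Zext_regular[of m] by (auto intro!: holomorphic_intros intro: holomorphic_on_subset)
  then have "zeta_ext holomorphic_on ?S"
    by (rule holomorphic_transform) (use zeta_ext_eq in auto)
  moreover have "Re z > 1 - real m" unfolding m_def by linarith
  with z have "z \<in> ?S" by auto
  ultimately show "\<exists>f'. (zeta_ext has_field_derivative f') (at z)"
    using op holomorphic_on_open by blast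
qed

lemma zeta_ext_sums:
  assumes "Re s > 1"
  shows "(\<lambda>n. 1 / of_nat (Suc n) powr s) sums zeta_ext s"
proof -
  have "zeta_ext s = hsum s 1" using zeta_ext_eq[of 0 s] assms by (cases "s = 1") auto
  moreover have "complex_of_real (real n + 1) powr (- s) = 1 / of_nat (Suc n) powr s" for n
    by (simp add: powr_minus divide_inverse add.commute)
  ultimately show ?thesis using hsum_sums[of s 1] assms by simp
qed

text \<open>Uniqueness is the identity theorem on the connected set - {1}, starting from the
  half-plane where both functions sum the same series; at 1 both are 0.\<close>

lemma zeta_eq_zeta_ext: "zeta = zeta_ext"
  unfolding zeta_def
proof (rule the_equality)
  show "zeta_ext holomorphic_on - {1} \<and>
      (\<forall>s. Re s > 1 \<longrightarrow> (\<lambda>n. 1 / of_nat (Suc n) powr s) sums zeta_ext s) \<and> zeta_ext 1 = 0"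
    using zeta_ext_holomorphic zeta_ext_sums by (auto simp: zeta_ext_def)
next
  fix f assume f: "f holomorphic_on - {1} \<and>
      (\<forall>s. Re s > 1 \<longrightarrow> (\<lambda>n. 1 / of_nat (Suc n) powr s) sums f s) \<and> f 1 = 0"
  have "f z = zeta_ext z" if "z \<noteq> 1" for z
  proof (rule analytic_continuation_open[of "{s. Re s > 1}" "- {1}" f zeta_ext])
    show "{s. Re s > 1} \<noteq> {}" by (auto intro!: exI[of _ 2])
    show "connected (- {1 :: complex})" by (rule connected_punctured_universe) simp
    show "f z = zeta_ext z" if "z \<in> {s. Re s > 1}" for z
      using f zeta_ext_sums[of z] that sums_unique2 by blast
  qed (use f that zeta_ext_holomorphic in \<open>auto simp: open_halfspace_Re_gt\<close>)
  then show "f = zeta_ext" using f by (force simp: zeta_ext_def fun_eq_iff)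
qed

section \<open>Bounding zeta for Re s > 0\<close>

text \<open>In the integral form of the term, the weight 1 - v is at most 1 and the rest has norm
  |s| (x + v)^(-Re s - 1), whose integral is a difference that telescopes over x = n + 1.\<close>

lemma norm_hurwitz_term_le:
  assumes "x > 0" "Re s > 0" "s \<noteq> 1"
  shows "norm (of_real x powr (- s) - (of_real x powr (1 - s) - of_real (x + 1) powr (1 - s)) / (s - 1))
    \<le> norm s / Re s * (x powr (- Re s) - (x + 1) powr (- Re s))"
proof -
  have "((\<lambda>v. norm s * (x + v) powr (- Re s - 1)) has_integral
      - (norm s / Re s * (x + 1) powr (- Re s)) - - (norm s / Re s * (x + 0) powr (- Re s))) {0..1}"
    using assms
    by (intro fundamental_theorem_of_calculus)
       (auto intro!: derivative_eq_intros simp flip: has_real_derivative_iff_has_vector_derivative)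
  then have b: "((\<lambda>v. norm s * (x + v) powr (- Re s - 1)) has_integral
      norm s / Re s * (x powr (- Re s) - (x + 1) powr (- Re s))) {0..1}"
    by (simp add: algebra_simps)
  note a = has_integral_hurwitz_term[OF assms(1,3)]
  have "norm (of_real (1 - v) * (s * complex_of_real (x + v) powr (- (s + 1))))
      \<le> norm s * (x + v) powr (- Re s - 1)" if "v \<in> {0..1}" for v
  proof -
    have "norm (complex_of_real (x + v) powr (- (s + 1))) = (x + v) powr (- Re s - 1)"
      using norm_of_real_powr[of "x + v" "- (s + 1)"] assms that by simp
    moreover have "norm (complex_of_real (1 - v)) \<le> 1" using that by (simp only: norm_of_real) simp
    ultimately show ?thesis
      by (simp add: norm_mult mult_left_le_one_le del: of_real_diff of_real_add)
  qed
  then show ?thesis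
    using integral_norm_bound_integral[OF has_integral_integrable[OF a] has_integral_integrable[OF b]]
    unfolding integral_unique[OF a] integral_unique[OF b] by blast
qed

lemma norm_zeta_le:
  assumes "Re s > 0" "s \<noteq> 1"
  shows "norm (zeta s) \<le> 1 / norm (s - 1) + norm s / Re s"
proof -
  let ?g = "\<lambda>n. of_real (real n + 1) powr (- s) -
      (of_real (real n + 1) powr (1 - s) - of_real (real (Suc n) + 1) powr (1 - s)) / (s - 1)"
  let ?G = "integral {0..1} (\<lambda>v. of_real (1 - v) * (s * hsum (s + 1) (1 + v)))"
  let ?b = "\<lambda>n. norm s / Re s * ((real n + 1) powr (- Re s) - (real (Suc n) + 1) powr (- Re s))"
  \<comment> \<open>Depth m = 1 suffices for Re s > 0; the inner \<open>Zext 0\<close> at s + 1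
    unfolds to s \<open>hsum\<close> (s + 1) (1 + v), and 1^(1-s) = 1.\<close>
  have z: "zeta s = 1 / (s - 1) + ?G"
    using zeta_ext_eq[of 1 s] assms
    by (simp add: zeta_eq_zeta_ext field_simps)
  have g: "?g sums ?G" using hurwitz_shift_sums[of s 1] assms by simp
  have "(\<lambda>n. (real n + 1) powr (- Re s)) \<longlonglongrightarrow> 0"
    using assms
    by (intro tendsto_neg_powr)
       (auto intro!: filterlim_tendsto_add_at_top filterlim_real_sequentially simp: add.commute)
  \<comment> \<open>The telescoping sum equals its first value, 1^(-Re s) = 1, which leaves exactly
    |s| / Re s.\<close>
  from sums_mult[OF telescope_sums'[OF this], of "norm s / Re s"]
  have b: "?b sums (norm s / Re s)" by simp
  have "norm (?g n) \<le> ?b n" for n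
    using norm_hurwitz_term_le[of "real n + 1" s] assms by (simp add: add_ac)
  then have "norm ?G \<le> norm s / Re s"
    using norm_suminf_le[of ?g ?b] g b by (simp add: sums_iff)
  then show ?thesis
    unfolding z using norm_triangle_ineq[of "1 / (s - 1)" ?G] by (simp add: norm_divide)
qed

theorem corollary9:
  fixes \<sigma> t :: real
  assumes "\<sigma> \<ge> 1/2" and "t \<ge> 2"
  shows "norm (zeta (of_real \<sigma> + \<i> * of_real t)) \<le> 3 * t"
proof -
  let ?s = "of_real \<sigma> + \<i> * of_real t"
  \<comment> \<open>The imaginary part alone keeps \<open>?s\<close> at distance at least t \<ge> 2
    from the pole.\<close>
  have "t \<le> norm (?s - 1)" using abs_Im_le_cmod[of "?s - 1"] assms by simp
  then have 1: "1 / norm (?s - 1) \<le> 1 / 2" using assms by (intro divide_left_mono) auto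
  have "norm ?s \<le> \<sigma> + t"
    using norm_triangle_ineq[of "of_real \<sigma>" "\<i> * of_real t"] assms by (simp add: norm_mult)
  then have "norm ?s / \<sigma> \<le> (\<sigma> + t) / \<sigma>" using assms by (intro divide_right_mono) auto
  also have "\<dots> = 1 + t / \<sigma>" using assms by (simp add: field_simps)
  \<comment> \<open>The bound \<sigma> \<ge> 1/2 yields the factor 2 here.\<close>
  also have "t / \<sigma> \<le> t / (1/2)" using assms by (intro divide_left_mono) auto
  finally have 2: "norm ?s / \<sigma> \<le> 1 + 2 * t" by simp
  have "?s \<noteq> 1" using assms by (auto simp: complex_eq_iff)
  then have "norm (zeta ?s) \<le> 1 / norm (?s - 1) + norm ?s / \<sigma>"
    using norm_zeta_le[of ?s] assms by simp
  \<comment> \<open>The total is 1/2 + 1 + 2t, at most 3t because t \<ge> 3/2.\<close>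
  with 1 2 assms show ?thesis by linarith
qed

end
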